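(* Let $(x_n)_{n\ge0}$ be the $\mathbb R^d$-valued iterates $x_{n+1}=x_n+a(n)[h(x_n)+M_{n+1}]$, and let $V$ and $H$ be the Liapunov function and the compact set described in the context. Assume: (A1) $h:\mathbb R^d\to\mathbb R^d$ is Lipschitz; (A2) $a(n)>0$, $\sum_n a(n)=\infty$, $\sum_n a(n)^2<\infty$, and there is $c>0$ such that $a(n)\le c\,a(m)$ for all $n\ge m$; (A3) $(M_n)_{n\ge1}$ is a square integrable martingale difference sequence with respect to $\mathcal F_n=\sigma(x_0,M_1,\ldots,M_n)$, i.e. $E[M_{n+1}\mid\mathcal F_n]=0$ a.s. for all $n\ge0$, and $E[\|M_{n+1}\|^2\mid\mathcal F_n]\le c(1+\|x_n\|^2)$ a.s. for all $n\ge 0$ and some $0<c<\infty$; (A4) $V$ is twice differentiable and $|\partial_i\partial_jV(x)|<c$ for all $i,j$ and $x$, for some $0<c<\infty$; (A5) $\|x\|^2<c(1+V(x))$ for all $x$ and some $0<c<\infty$. Then $$\mathbb P[x_n\rightarrow H]=1.$$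
   Context: $V:\mathbb R^d\to[0,\infty)$ is differentiable with $\lim_{\|x\|\uparrow\infty}V(x)=\infty$ and $\nabla V(x)\cdot h(x)\le 0$ for all $x$. $H:=\{x:\nabla V(x)\cdot h(x)=0\}$ is assumed to coincide with $\{x:V(x)=0\}$ (so $H$ is compact). $x_n\to H$ means that the distance from $x_n$ to $H$ tends to $0$. *)

theory Defs
  imports "HOL-Probability.Probability"
begin

definition partial_deriv :: "'d \<Rightarrow> (real ^ 'd \<Rightarrow> real) \<Rightarrow> real ^ 'd \<Rightarrow> real" where
  "partial_deriv i f x = deriv (\<lambda>t. f (x + t *\<^sub>R axis i 1)) 0"

definition grad :: "(real ^ 'd \<Rightarrow> real) \<Rightarrow> real ^ 'd \<Rightarrow> real ^ 'd" where
  "grad f x = (\<chi> i. partial_deriv i f x)"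

(* The sigma-algebra generated by x0, M 1, ..., M n; the value M 0 plays no role. *)
definition noise_filtration ::
    "'w measure \<Rightarrow> ('w \<Rightarrow> real ^ 'd) \<Rightarrow> (nat \<Rightarrow> 'w \<Rightarrow> real ^ 'd) \<Rightarrow> nat \<Rightarrow> 'w measure" where
  "noise_filtration P x0 M n =
     sigma (space P)
       ({x0 -` A \<inter> space P | A. A \<in> sets borel} \<union>
        {M k -` A \<inter> space P | k A. k \<in> {1..n} \<and> A \<in> sets borel})"

(* The library's conditional expectation is real-valued; for vectors it is taken componentwise. *)
definition vec_cond_exp ::
    "'w measure \<Rightarrow> 'w measure \<Rightarrow> ('w \<Rightarrow> real ^ 'd) \<Rightarrow> 'w \<Rightarrow> real ^ 'd" where
  "vec_cond_exp P F X \<omega> = (\<chi> i. real_cond_exp P F (\<lambda>w. X w $ i) \<omega>)"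

end

theory Submission
  imports Defs
begin

text \<open>The proof treats \<open>V\<close> along the iterates as an almost supermartingale and does not compare the
iterates with trajectories of the differential equation \<open>dx/dt = h(x)\<close>.

Bounded second partial derivatives make \<open>grad V\<close> Lipschitz, so
\<open>V (x + u) \<le> V x + grad V x \<bullet> u + K * (norm u)\<^sup>2\<close> (\<open>quadratic_upper_bound\<close>). For
\<open>u = a n (h (x n) + M (n + 1))\<close>, conditioning on the past kills the term linear in the noise,
and the quadratic term costs at most a multiple of \<open>(a n)\<^sup>2 (1 + V (x n))\<close>: by the growth
condition on \<open>V\<close>, the squared norms of \<open>x n\<close>, of \<open>h (x n)\<close>, of \<open>grad V (x n)\<close> and the conditional
variance of the noise are all \<open>O(1 + V (x n))\<close>. With \<open>g = - grad V \<bullet> h \<ge> 0\<close> this reads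
\<open>E[1 + V (x (n + 1)) | F n] \<le> (1 + C (a n)\<^sup>2) (1 + V (x n)) - a n g (x n)\<close>
(\<open>expected_lyapunov_step\<close>).

As the sum of the \<open>(a n)\<^sup>2\<close> is finite, the theorem of Robbins and Siegmund (\<open>robbins_siegmund\<close>) applies:
almost surely \<open>V (x n)\<close> converges and the sum of the \<open>a n g (x n)\<close> is finite. That theorem reduces to
almost sure convergence of nonnegative supermartingales, which is obtained from Doob's upcrossing
inequality.

The rest concerns single paths (\<open>lyapunov_convergent_imp_infdist\<close>). By coercivity the path is bounded.
If \<open>V (x n)\<close> had a positive limit, the path would eventually stay in a compact set on which \<open>g\<close> is
positive, since \<open>g\<close> vanishes only where \<open>V\<close> does; then \<open>g (x n)\<close> would be bounded away from
zero and the sum of the \<open>a n g (x n)\<close> infinite. Hence \<open>V (x n)\<close> tends to \<open>0\<close>, and compactness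
once more turns this into convergence of the distance to the zero set of \<open>V\<close>.

The expectation of \<open>V (x 0)\<close> may be infinite. This is handled by the weight \<open>w = 1 / (1 + V (x 0))\<close>, a
positive function of \<open>x 0\<close>, at most one: \<open>w (1 + V (x 0)) = 1\<close>, so all \<open>w (1 + V (x n))\<close> are integrable,
the weight can be moved through every conditional expectation, and pathwise it is a harmless
constant factor.\<close>

section \<open>Convergence of nonnegative supermartingales\<close>

text \<open>An upcrossing starts when \<open>y\<close> drops below \<open>a\<close> and is completed when \<open>y\<close> next exceeds \<open>b\<close>. As a
betting strategy, \<open>upcrossing_active\<close> says whether one unit of \<open>y\<close> is held from time \<open>n\<close> to
\<open>n + 1\<close>; since this is decided by the values up to time \<open>n\<close>, holding a supermartingale in this
way has no positive expected gain.\<close>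
primrec upcrossing_active :: "real \<Rightarrow> real \<Rightarrow> (nat \<Rightarrow> real) \<Rightarrow> nat \<Rightarrow> bool" where
  "upcrossing_active a b y 0 \<longleftrightarrow> y 0 < a"
| "upcrossing_active a b y (Suc n) \<longleftrightarrow>
     (if upcrossing_active a b y n then y (Suc n) \<le> b else y (Suc n) < a)"

primrec upcrossings :: "real \<Rightarrow> real \<Rightarrow> (nat \<Rightarrow> real) \<Rightarrow> nat \<Rightarrow> nat" where
  "upcrossings a b y 0 = 0"
| "upcrossings a b y (Suc n) =
     upcrossings a b y n + (if upcrossing_active a b y n \<and> b < y (Suc n) then 1 else 0)"

lemma upcrossings_mono: "m \<le> n \<Longrightarrow> upcrossings a b y m \<le> upcrossings a b y n"
  by (rule lift_Suc_mono_le) auto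

text \<open>Every completed upcrossing earns at least \<open>b - a\<close>. The second summand is the potential that makes
the induction work: the unit currently held was bought below \<open>a\<close>, so the loss on the uncompleted
upcrossing is at most \<open>a - y n\<close>.\<close>
lemma upcrossings_gain:
  assumes "a < b"
  shows "(b - a) * real (upcrossings a b y n)
      + (if upcrossing_active a b y n then y n - a else 0)
    \<le> (\<Sum>k<n. (if upcrossing_active a b y k then 1 else 0) * (y (Suc k) - y k))"
  using assms by (induction n) (auto simp: algebra_simps)

text \<open>Once the upcrossing count is constant, a drop below \<open>a\<close> starts an upcrossing that is never
completed, so \<open>y\<close> never exceeds \<open>b\<close> again.\<close>
lemma bounded_upcrossings_not_oscillating:
  assumes ab: "a < b" and bdd: "\<And>n. upcrossings a b y n \<le> B"
    and low: "frequently (\<lambda>n. y n < a) sequentially"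
  shows "eventually (\<lambda>n. y n \<le> b) sequentially"
proof -
  have "finite (range (upcrossings a b y))"
    by (rule finite_subset[of _ "{..B}"]) (use bdd in auto)
  then obtain N where N: "upcrossings a b y N = Max (range (upcrossings a b y))"
    using Max_in[of "range (upcrossings a b y)"] by (metis UNIV_I empty_iff image_eqI rangeE)
  have const: "upcrossings a b y n \<le> upcrossings a b y N" for n
    unfolding N using \<open>finite _\<close> by (intro Max_ge) auto
  obtain m where m: "m \<ge> Suc N" "y m < a"
    using low by (auto simp: frequently_sequentially)
  then obtain m' where [simp]: "m = Suc m'" by (cases m) auto
  have act_m: "upcrossing_active a b y m"
    using m ab by auto
  have "upcrossing_active a b y n \<and> y n \<le> b" if "n \<ge> m" for n
    using that
  proof (induction n rule: dec_induct)
    case base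
    then show ?case using act_m m ab by auto
  next
    case (step n)
    have "upcrossings a b y N \<le> upcrossings a b y n"
      using step m by (intro upcrossings_mono) auto
    with const[of "Suc n"] step show ?case by (auto split: if_splits)
  qed
  then show ?thesis
    by (auto simp: eventually_sequentially)
qed

text \<open>A gap between the limit inferior and the limit superior would contain two rationals between
which the sequence oscillates. The bound \<open>C\<close> only keeps the limit finite.\<close>
lemma convergent_if_not_oscillating:
  fixes y :: "nat \<Rightarrow> real"
  assumes nonneg: "\<And>n. 0 \<le> y n"
    and freq: "frequently (\<lambda>n. y n < C) sequentially"
    and osc: "\<And>a b :: rat. 0 \<le> a \<Longrightarrow> a < b \<Longrightarrow> frequently (\<lambda>n. y n < of_rat a) sequentially
      \<Longrightarrow> eventually (\<lambda>n. y n \<le> of_rat b) sequentially"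
  shows "convergent y"
proof -
  let ?i = "liminf (\<lambda>n. ereal (y n))" and ?s = "limsup (\<lambda>n. ereal (y n))"
  have i0: "0 \<le> ?i"
    by (rule Liminf_bounded) (use nonneg in auto)
  have iC: "?i \<le> ereal C"
  proof (rule ccontr)
    assume "\<not> ?thesis"
    then have "ereal C < ?i" by simp
    then have "eventually (\<lambda>n. ereal C < ereal (y n)) sequentially"
      by (rule less_LiminfD)
    then show False using freq
      by (auto simp: frequently_def elim!: notE eventually_mono)
  qed
  have "?i = ?s"
  proof (rule ccontr)
    assume "?i \<noteq> ?s"
    then have "?i < ?s" using Liminf_le_Limsup[of sequentially "\<lambda>n. ereal (y n)"] by auto
    then obtain b' where b': "?i < ereal b'" "ereal b' < ?s" using ereal_dense2 by blast
    obtain a' where a': "?i < ereal a'" "ereal a' < ereal b'" using ereal_dense2 b' by blast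
    obtain c' where c': "ereal b' < ereal c'" "ereal c' < ?s" using ereal_dense2 b' by blast
    obtain a where a: "a' < of_rat a" "of_rat a < b'" using of_rat_dense[of a' b'] a' by auto
    obtain b where b: "b' < of_rat b" "of_rat b < c'" using of_rat_dense[of b' c'] c' by auto
    have "0 < a'" using i0 a' by (metis ereal_less(2) order_le_less_trans)
    then have "0 \<le> a" using a by (metis less_trans less_imp_le zero_less_of_rat_iff)
    moreover have "a < b" using a b by (metis less_trans of_rat_less)
    moreover have "frequently (\<lambda>n. y n < of_rat a) sequentially"
    proof (rule ccontr)
      assume "\<not> ?thesis"
      then have "eventually (\<lambda>n. ereal (of_rat a) \<le> ereal (y n)) sequentially"
        by (simp add: not_frequently not_less)
      then have "ereal (of_rat a) \<le> ?i" by (rule Liminf_bounded)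
      then show False using a a' by (metis ereal_less_eq(3) less_trans not_le ereal_less(1) less_ereal.simps(1))
    qed
    ultimately have "eventually (\<lambda>n. y n \<le> of_rat b) sequentially" by (rule osc)
    then have "?s \<le> ereal (of_rat b)"
      by (intro Limsup_bounded) auto
    then show False using b c'
      by (metis less_ereal.simps(1) less_trans not_le)
  qed
  moreover obtain l where l: "?i = ereal l"
    using i0 iC by (cases ?i) auto
  ultimately have "(\<lambda>n. ereal (y n)) \<longlonglongrightarrow> ereal l"
    by (intro Liminf_eq_Limsup) auto
  then show ?thesis by (auto simp: convergent_def)
qed

lemma measurable_upcrossing_active:
  assumes F_mono: "\<And>n. sets (F n) \<subseteq> sets (F (Suc n))" and F_space: "\<And>n. space (F n) = \<Omega>"
    and Y: "\<And>n. Y n \<in> borel_measurable (F n)"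
  shows "{\<omega>\<in>\<Omega>. upcrossing_active a b (\<lambda>k. Y k \<omega>) n} \<in> sets (F n)"
proof (induction n)
  case 0
  have "{\<omega>\<in>space (F 0). Y 0 \<omega> < a} \<in> sets (F 0)" using Y[of 0] by measurable
  then show ?case by (simp add: F_space)
next
  case (Suc n)
  have [measurable]: "{\<omega>\<in>\<Omega>. upcrossing_active a b (\<lambda>k. Y k \<omega>) n} \<in> sets (F (Suc n))"
    using Suc F_mono by auto
  then have [measurable]: "Measurable.pred (F (Suc n)) (\<lambda>\<omega>. upcrossing_active a b (\<lambda>k. Y k \<omega>) n)"
    by (simp add: pred_def F_space)
  have [measurable]: "Y (Suc n) \<in> borel_measurable (F (Suc n))" by fact
  have "{\<omega>\<in>space (F (Suc n)). upcrossing_active a b (\<lambda>k. Y k \<omega>) (Suc n)} \<in> sets (F (Suc n))"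
    unfolding upcrossing_active.simps by measurable
  then show ?case by (simp add: F_space)
qed

text \<open>Doob's upcrossing inequality: taking expectations in \<open>upcrossings_gain\<close>, the gain has expectation at
most zero and, as \<open>Y n \<ge> 0\<close>, the loss on the uncompleted upcrossing is at most \<open>a\<close>. Here and below
the supermartingale property is stated through integrals over the sets of \<open>F n\<close>.\<close>
lemma expected_upcrossings_le:
  assumes P: "prob_space P" and sub: "\<And>n. subalgebra P (F n)"
    and F_mono: "\<And>n. sets (F n) \<subseteq> sets (F (Suc n))"
    and Y: "\<And>n. Y n \<in> borel_measurable (F n)" and int: "\<And>n. integrable P (Y n)"
    and nonneg: "\<And>n \<omega>. (0::real) \<le> Y n \<omega>"
    and super: "\<And>n A. A \<in> sets (F n) \<Longrightarrow>
      (\<integral>\<omega>. indicator A \<omega> * Y (Suc n) \<omega> \<partial>P) \<le> (\<integral>\<omega>. indicator A \<omega> * Y n \<omega> \<partial>P)"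
    and ab: "0 \<le> a" "a < b"
  shows "(\<lambda>\<omega>. upcrossings a b (\<lambda>k. Y k \<omega>) n) \<in> measurable P (count_space UNIV)"
    and "(\<integral>\<^sup>+\<omega>. ennreal (upcrossings a b (\<lambda>k. Y k \<omega>) n) \<partial>P) \<le> ennreal (a / (b - a))"
proof -
  interpret prob_space P by fact
  \<comment> \<open>\<open>S\<close> is the gain of the strategy, each \<open>C k\<close> belonging to the information at time \<open>k\<close>.\<close>
  define C where "C k = {\<omega>\<in>space P. upcrossing_active a b (\<lambda>k. Y k \<omega>) k}" for k
  have C: "C k \<in> sets (F k)" for k
    unfolding C_def using sub by (intro measurable_upcrossing_active F_mono Y) (auto simp: subalgebra_def)
  have CP[measurable]: "C k \<in> sets P" for k using C[of k] sub[of k] by (auto simp: subalgebra_def)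
  then have [measurable]: "Measurable.pred P (\<lambda>\<omega>. upcrossing_active a b (\<lambda>k. Y k \<omega>) k)" for k
    by (simp add: pred_def C_def)
  have [measurable]: "Y k \<in> borel_measurable P" for k using int by auto
  show U[measurable]: "(\<lambda>\<omega>. upcrossings a b (\<lambda>k. Y k \<omega>) n) \<in> measurable P (count_space UNIV)" for n
    by (induction n) (simp_all)
  define S where "S \<omega> = (\<Sum>k<n. indicator (C k) \<omega> * (Y (Suc k) \<omega> - Y k \<omega>))" for \<omega>
  have intC: "integrable P (\<lambda>\<omega>. indicator (C k) \<omega> * Y j \<omega>)" for k j
    using integrable_mult_indicator[OF CP[of k] int[of j]] by simp
  have intS: "integrable P S"
    unfolding S_def right_diff_distrib by (intro Bochner_Integration.integrable_sum Bochner_Integration.integrable_diff intC)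
  have ES: "(\<integral>\<omega>. S \<omega> \<partial>P) \<le> 0"
    unfolding S_def right_diff_distrib
    by (subst Bochner_Integration.integral_sum,
        (intro Bochner_Integration.integrable_diff intC),
        intro sum_nonpos, subst Bochner_Integration.integral_diff, (intro intC)+, simp add: super C)
  have path: "(b - a) * real (upcrossings a b (\<lambda>k. Y k \<omega>) n) \<le> S \<omega> + a" if "\<omega> \<in> space P" for \<omega>
  proof -
    have "indicator (C k) \<omega> = (if upcrossing_active a b (\<lambda>k. Y k \<omega>) k then 1 else 0::real)" for k
      using that by (auto simp: C_def)
    then show ?thesis
      using upcrossings_gain[OF ab(2), of "\<lambda>k. Y k \<omega>" n] nonneg[of n \<omega>] ab
      unfolding S_def by (auto split: if_splits)
  qed
  have "(\<integral>\<^sup>+\<omega>. ennreal (upcrossings a b (\<lambda>k. Y k \<omega>) n) \<partial>P)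
      \<le> (\<integral>\<^sup>+\<omega>. ennreal ((S \<omega> + a) / (b - a)) \<partial>P)"
    by (intro nn_integral_mono ennreal_leI) (use path ab in \<open>auto simp: field_simps\<close>)
  also have "\<dots> = ennreal (\<integral>\<omega>. (S \<omega> + a) / (b - a) \<partial>P)"
  proof (rule nn_integral_eq_integral)
    show "integrable P (\<lambda>\<omega>. (S \<omega> + a) / (b - a))" using intS by auto
    show "AE \<omega> in P. 0 \<le> (S \<omega> + a) / (b - a)"
    proof (rule AE_I2)
      fix \<omega> assume "\<omega> \<in> space P"
      then have "0 \<le> S \<omega> + a" 
        using path[of \<omega>] ab by (meson diff_ge_0_iff_ge less_imp_le mult_nonneg_nonneg of_nat_0_le_iff order_trans)
      then show "0 \<le> (S \<omega> + a) / (b - a)" using ab by auto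
    qed
  qed
  also have "\<dots> \<le> ennreal (a / (b - a))"
    using ES intS ab by (intro ennreal_leI) (simp add: divide_right_mono prob_space)
  finally show "(\<integral>\<^sup>+\<omega>. ennreal (upcrossings a b (\<lambda>k. Y k \<omega>) n) \<partial>P) \<le> ennreal (a / (b - a))" .
qed

text \<open>By the upcrossing inequality, for each of the countably many pairs of rationals \<open>0 \<le> a < b\<close> almost
every path crosses from below \<open>a\<close> to above \<open>b\<close> only finitely often. Fatou's lemma shows that the
limit inferior is almost surely finite, which excludes divergence to infinity.\<close>
lemma nonneg_supermartingale_convergent:
  assumes P: "prob_space P" and sub: "\<And>n. subalgebra P (F n)"
    and F_mono: "\<And>n. sets (F n) \<subseteq> sets (F (Suc n))"
    and Y: "\<And>n. Y n \<in> borel_measurable (F n)" and int: "\<And>n. integrable P (Y n)"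
    and nonneg: "\<And>n \<omega>. (0::real) \<le> Y n \<omega>"
    and super: "\<And>n A. A \<in> sets (F n) \<Longrightarrow>
      (\<integral>\<omega>. indicator A \<omega> * Y (Suc n) \<omega> \<partial>P) \<le> (\<integral>\<omega>. indicator A \<omega> * Y n \<omega> \<partial>P)"
  shows "AE \<omega> in P. convergent (\<lambda>n. Y n \<omega>)"
proof -
  interpret prob_space P by fact
  have [measurable]: "Y k \<in> borel_measurable P" for k using int by auto
  have EY: "(\<integral>\<^sup>+\<omega>. ennreal (Y n \<omega>) \<partial>P) \<le> ennreal (\<integral>\<omega>. Y 0 \<omega> \<partial>P)" for n
  proof -
    have "(\<integral>\<omega>. Y (Suc n) \<omega> \<partial>P) \<le> (\<integral>\<omega>. Y n \<omega> \<partial>P)" for n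
    proof -
      have sp: "space P \<in> sets (F n)" using sub[of n] sets.top[of "F n"] by (simp add: subalgebra_def)
      have "(\<integral>\<omega>. indicator (space P) \<omega> * Y k \<omega> \<partial>P) = (\<integral>\<omega>. Y k \<omega> \<partial>P)" for k
        by (rule Bochner_Integration.integral_cong) auto
      then show ?thesis using super[OF sp] by simp
    qed
    then have "(\<integral>\<omega>. Y n \<omega> \<partial>P) \<le> (\<integral>\<omega>. Y 0 \<omega> \<partial>P)"
      by (induction n) (auto intro: order_trans)
    then show ?thesis
      by (subst nn_integral_eq_integral) (auto simp: int nonneg intro!: ennreal_leI)
  qed
  have "(\<integral>\<^sup>+\<omega>. liminf (\<lambda>n. ennreal (Y n \<omega>)) \<partial>P) \<le> liminf (\<lambda>n. \<integral>\<^sup>+\<omega>. ennreal (Y n \<omega>) \<partial>P)"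
    by (rule nn_integral_liminf) auto
  also have "\<dots> \<le> ennreal (\<integral>\<omega>. Y 0 \<omega> \<partial>P)"
    by (rule order_trans[OF Liminf_le_Limsup Limsup_bounded]) (auto simp: EY)
  finally have "(\<integral>\<^sup>+\<omega>. liminf (\<lambda>n. ennreal (Y n \<omega>)) \<partial>P) \<noteq> \<infinity>"
    by (auto simp: top_unique)
  then have 1: "AE \<omega> in P. liminf (\<lambda>n. ennreal (Y n \<omega>)) \<noteq> \<infinity>"
    by (intro nn_integral_noteq_infinite) auto
  have 2: "AE \<omega> in P. 0 \<le> a \<and> a < b \<longrightarrow>
      (SUP n. ennreal (upcrossings (of_rat a) (of_rat b) (\<lambda>k. Y k \<omega>) n)) \<noteq> \<infinity>" for a b :: rat
  proof (cases "0 \<le> a \<and> a < b")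
    case True
    then have ab: "0 \<le> real_of_rat a" "real_of_rat a < of_rat b" by (auto simp: of_rat_less)
    note up = expected_upcrossings_le[where P = P and F = F and Y = Y, OF P sub F_mono Y int nonneg super ab]
    have [measurable]: "(\<lambda>\<omega>. real (upcrossings (of_rat a) (of_rat b) (\<lambda>k. Y k \<omega>) n)) \<in> borel_measurable P" for n
      by (rule measurable_compose[OF up(1) borel_measurable_count_space])
    have "(\<integral>\<^sup>+\<omega>. (SUP n. ennreal (upcrossings (of_rat a) (of_rat b) (\<lambda>k. Y k \<omega>) n)) \<partial>P)
      = (SUP n. \<integral>\<^sup>+\<omega>. ennreal (upcrossings (of_rat a) (of_rat b) (\<lambda>k. Y k \<omega>) n) \<partial>P)"
      by (rule nn_integral_monotone_convergence_SUP)
        (auto simp: incseq_def le_fun_def intro!: ennreal_leI upcrossings_mono)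
    also have "\<dots> \<le> ennreal (of_rat a / (of_rat b - of_rat a))"
      by (intro SUP_least up(2))
    finally have "(\<integral>\<^sup>+\<omega>. (SUP n. ennreal (upcrossings (of_rat a) (of_rat b) (\<lambda>k. Y k \<omega>) n)) \<partial>P) \<noteq> \<infinity>"
      by (auto simp: top_unique)
    then have "AE \<omega> in P. (SUP n. ennreal (upcrossings (of_rat a) (of_rat b) (\<lambda>k. Y k \<omega>) n)) \<noteq> \<infinity>"
      by (intro nn_integral_noteq_infinite) auto
    then show ?thesis by auto
  qed auto
  have "AE \<omega> in P. \<forall>a b :: rat. 0 \<le> a \<and> a < b \<longrightarrow>
      (SUP n. ennreal (upcrossings (of_rat a) (of_rat b) (\<lambda>k. Y k \<omega>) n)) \<noteq> \<infinity>"
    using 2 by (simp add: AE_all_countable)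
  with 1 show ?thesis
  proof eventually_elim
    case (elim \<omega>)
    then obtain C where C: "liminf (\<lambda>n. ennreal (Y n \<omega>)) = ennreal C" "0 \<le> C"
      by (cases "liminf (\<lambda>n. ennreal (Y n \<omega>))") auto
    show ?case
    proof (rule convergent_if_not_oscillating)
      show "frequently (\<lambda>n. Y n \<omega> < C + 1) sequentially"
      proof (rule ccontr)
        assume "\<not> ?thesis"
        then have "eventually (\<lambda>n. ennreal (C + 1) \<le> ennreal (Y n \<omega>)) sequentially"
          by (auto simp: not_frequently not_less elim!: eventually_mono intro: ennreal_leI)
        then have "ennreal (C + 1) \<le> ennreal C" unfolding C(1)[symmetric] by (rule Liminf_bounded)
        then show False using C(2) by (simp add: ennreal_le_iff)
      qed
    next
      fix a b :: rat
      assume ab: "0 \<le> a" "a < b" and low: "frequently (\<lambda>n. Y n \<omega> < of_rat a) sequentially"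
      let ?U = "\<lambda>n. upcrossings (of_rat a) (of_rat b) (\<lambda>k. Y k \<omega>) n"
      from elim ab have "(SUP n. ennreal (?U n)) \<noteq> \<infinity>" by blast
      then obtain r where r: "(SUP n. ennreal (?U n)) = ennreal r" "0 \<le> r"
        by (cases "SUP n. ennreal (?U n)") auto
      have "?U n \<le> nat \<lfloor>r\<rfloor>" for n
      proof -
        have "ennreal (?U n) \<le> ennreal r" unfolding r(1)[symmetric] by (rule SUP_upper) auto
        then have "real (?U n) \<le> r" using r(2) by (simp add: ennreal_le_iff)
        then show ?thesis by linarith
      qed
      then show "eventually (\<lambda>n. Y n \<omega> \<le> of_rat b) sequentially"
        using ab low by (intro bounded_upcrossings_not_oscillating[of "of_rat a"]) (auto simp: of_rat_less)
    qed (fact nonneg)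
  qed
qed

section \<open>Gradients and Taylor's inequality\<close>

lemma partial_deriv_eq_derivative:
  fixes f :: "real ^ 'd \<Rightarrow> real"
  assumes "(f has_derivative f') (at y)"
  shows "partial_deriv i f y = f' (axis i 1)"
proof -
  have "((\<lambda>t::real. y + t *\<^sub>R axis i 1) has_derivative (\<lambda>t. t *\<^sub>R axis i 1)) (at 0)"
    by (auto intro!: derivative_eq_intros)
  then have "((\<lambda>t. f (y + t *\<^sub>R axis i 1)) has_derivative (\<lambda>t. f' (t *\<^sub>R axis i 1))) (at 0)"
    using has_derivative_compose[of "\<lambda>t::real. y + t *\<^sub>R axis i 1" "\<lambda>t. t *\<^sub>R axis i 1" 0 UNIV f f'] assms
    by simp
  moreover have "(\<lambda>t. f' (t *\<^sub>R axis i 1)) = (*) (f' (axis i 1))"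
    using assms[THEN has_derivative_linear] by (auto simp: linear_scale)
  ultimately have "((\<lambda>t. f (y + t *\<^sub>R axis i 1)) has_field_derivative f' (axis i 1)) (at 0)"
    by (simp add: has_field_derivative_def)
  then show ?thesis
    unfolding partial_deriv_def by (rule DERIV_imp_deriv)
qed

lemma has_derivative_grad:
  fixes V :: "real ^ 'd \<Rightarrow> real"
  assumes "V differentiable (at y)"
  shows "(V has_derivative (\<lambda>u. grad V y \<bullet> u)) (at y)"
proof -
  obtain f' where f': "(V has_derivative f') (at y)" using assms by (auto simp: differentiable_def)
  have "f' u = grad V y \<bullet> u" for u
  proof -
    have "f' u = f' (\<Sum>i\<in>UNIV. u $ i *\<^sub>R axis i 1)"
      using basis_expansion[of u] by (simp add: scalar_mult_eq_scaleR)
    also have "\<dots> = (\<Sum>i\<in>UNIV. u $ i * f' (axis i 1))"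
      using f'[THEN has_derivative_linear] by (simp add: linear_sum linear_scale)
    also have "\<dots> = grad V y \<bullet> u"
      by (simp add: inner_vec_def grad_def partial_deriv_eq_derivative[OF f'] mult.commute)
    finally show ?thesis .
  qed
  then have "f' = (\<lambda>u. grad V y \<bullet> u)" by auto
  with f' show ?thesis by simp
qed

text \<open>Row \<open>j\<close> of the derivative of \<open>grad V\<close> is the gradient of the \<open>j\<close>-th partial derivative of \<open>V\<close>, so its
entries are the second partial derivatives. Bounding the Euclidean norm by the sum of the absolute
values, for the vector \<open>u\<close> and for its image, gives one factor \<open>CARD('d)\<close> each.\<close>
lemma grad_lipschitz:
  fixes V :: "real ^ 'd \<Rightarrow> real"
  assumes diff: "\<And>y. grad V differentiable (at y)"
    and bound: "\<And>i j y. \<bar>partial_deriv i (partial_deriv j V) y\<bar> \<le> c"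
  shows "norm (grad V y - grad V z) \<le> (real CARD('d) * real CARD('d) * c) * norm (y - z)"
proof -
  define G' where "G' y = frechet_derivative (grad V) (at y)" for y
  have G': "(grad V has_derivative G' y) (at y)" for y
    using diff[of y] by (simp add: G'_def frechet_derivative_works)
  have row: "\<bar>G' y u $ j\<bar> \<le> real CARD('d) * c * norm u" for y u j
  proof -
    have "((\<lambda>y. grad V y $ j) has_derivative (\<lambda>u. G' y u $ j)) (at y)"
      by (rule bounded_linear.has_derivative[OF bounded_linear_vec_nth G'])
    then have d: "(partial_deriv j V has_derivative (\<lambda>u. G' y u $ j)) (at y)"
      by (simp add: grad_def)
    then have "(\<lambda>u. grad (partial_deriv j V) y \<bullet> u) = (\<lambda>u. G' y u $ j)"
      using has_derivative_grad[of "partial_deriv j V" y] has_derivative_unique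
      by (auto simp: differentiable_def)
    then have "G' y u $ j = grad (partial_deriv j V) y \<bullet> u" by (rule fun_cong[symmetric])
    then have "\<bar>G' y u $ j\<bar> = \<bar>\<Sum>i\<in>UNIV. partial_deriv i (partial_deriv j V) y * u $ i\<bar>"
      by (simp add: grad_def inner_vec_def)
    also have "\<dots> \<le> (\<Sum>i\<in>UNIV. \<bar>partial_deriv i (partial_deriv j V) y * u $ i\<bar>)"
      by (rule sum_abs)
    also have "\<dots> \<le> (\<Sum>i\<in>(UNIV::'d set). c * norm u)"
      unfolding abs_mult
      by (intro sum_mono mult_mono bound component_le_norm_cart order_trans[OF abs_ge_zero bound]) simp
    finally show ?thesis by simp
  qed
  have "norm (G' y u) \<le> (real CARD('d) * real CARD('d) * c) * norm u" for y u
  proof -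
    have "norm (G' y u) \<le> (\<Sum>j\<in>UNIV. \<bar>G' y u $ j\<bar>)" by (rule norm_le_l1_cart)
    also have "\<dots> \<le> (\<Sum>j\<in>(UNIV::'d set). real CARD('d) * c * norm u)"
      by (rule sum_mono) (rule row)
    finally show ?thesis by (simp add: mult_ac)
  qed
  then have "onorm (G' y) \<le> real CARD('d) * real CARD('d) * c" for y
    by (rule onorm_le)
  then show ?thesis
    by (intro differentiable_bound[of UNIV "grad V" G'])
      (auto intro: G' has_derivative_at_withinI)
qed

text \<open>By the mean value theorem the increment is \<open>G (y + t u) \<bullet> u\<close> for some \<open>t\<close> between \<open>0\<close> and \<open>1\<close>;
replacing the gradient there by \<open>G y\<close> costs at most \<open>K (norm u)\<^sup>2\<close>.\<close>
lemma quadratic_upper_bound: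
  fixes V :: "'a::real_inner \<Rightarrow> real"
  assumes deriv: "\<And>y. (V has_derivative (\<lambda>u. G y \<bullet> u)) (at y)"
    and lip: "\<And>y z. norm (G y - G z) \<le> K * norm (y - z)"
  shows "V (y + u) \<le> V y + G y \<bullet> u + K * (norm u)\<^sup>2"
proof -
  have "((\<lambda>t. V (y + t *\<^sub>R u)) has_derivative (\<lambda>s. G (y + t *\<^sub>R u) \<bullet> (s *\<^sub>R u))) (at t)" for t
    by (rule has_derivative_compose[OF _ deriv]) (auto intro!: derivative_eq_intros)
  then have d: "((\<lambda>t. V (y + t *\<^sub>R u)) has_real_derivative G (y + t *\<^sub>R u) \<bullet> u) (at t)" for t
    unfolding has_field_derivative_def by (rule has_derivative_eq_rhs) (auto simp: fun_eq_iff)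
  obtain t where t: "0 < t" "t < 1" "V (y + 1 *\<^sub>R u) - V (y + 0 *\<^sub>R u) = (1 - 0) * (G (y + t *\<^sub>R u) \<bullet> u)"
    using MVT2[OF zero_less_one, of "\<lambda>t. V (y + t *\<^sub>R u)" "\<lambda>t. G (y + t *\<^sub>R u) \<bullet> u"] d by blast
  have "(G (y + t *\<^sub>R u) - G y) \<bullet> u \<le> norm (G (y + t *\<^sub>R u) - G y) * norm u"
    by (rule norm_cauchy_schwarz)
  also have "\<dots> \<le> K * norm u * norm u"
  proof (rule mult_right_mono)
    have "norm (G (y + t *\<^sub>R u) - G y) \<le> K * norm (t *\<^sub>R u)" using lip[of "y + t *\<^sub>R u" y] by simp
    also have "\<dots> = t * (K * norm u)" using t by simp
    also have "\<dots> \<le> 1 * (K * norm u)"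
      using t order_trans[OF norm_ge_zero lip[of u 0]] by (intro mult_right_mono) auto
    finally show "norm (G (y + t *\<^sub>R u) - G y) \<le> K * norm u" by simp
  qed simp
  finally show ?thesis using t by (simp add: inner_diff_left power2_eq_square mult.assoc)
qed

section \<open>Paths along which a Lyapunov function converges\<close>

lemma pos_bounded_below_on_compact:
  fixes f :: "'a::topological_space \<Rightarrow> real"
  assumes "compact S" "continuous_on S f" "\<And>y. y \<in> S \<Longrightarrow> 0 < f y"
  obtains \<delta> where "0 < \<delta>" "\<And>y. y \<in> S \<Longrightarrow> \<delta> \<le> f y"
proof (cases "S = {}")
  case True
  then show thesis using that[of 1] by auto
next
  case False
  then obtain z where "z \<in> S" "\<forall>y\<in>S. f z \<le> f y"
    using continuous_attains_inf[OF assms(1) _ assms(2)] by auto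
  then show thesis using that[of "f z"] assms(3) by auto
qed

text \<open>If \<open>V (x n)\<close> had a limit \<open>v > 0\<close>, the bounded path would eventually remain in the compact set of
points of a large ball with \<open>V \<ge> v / 2\<close>. There \<open>g\<close> has a positive minimum, so the weighted sums of
\<open>g\<close> would grow like those of \<open>a\<close>, that is, without bound.\<close>
lemma lyapunov_convergent_imp_infdist:
  fixes V g :: "'a::euclidean_space \<Rightarrow> real" and x :: "nat \<Rightarrow> 'a"
  assumes V0: "\<And>y. 0 \<le> V y" and contV: "continuous_on UNIV V"
    and coercive: "filterlim V at_top at_infinity"
    and g0: "\<And>y. 0 \<le> g y" and contg: "continuous_on UNIV g"
    and zeros: "\<And>y. g y = 0 \<Longrightarrow> V y = 0"
    and a0: "\<And>n. 0 < a n" and asum: "filterlim (\<lambda>n. \<Sum>k<n. a k) at_top sequentially"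
    and conv: "convergent (\<lambda>n. V (x n))"
    and bdd: "\<And>n. (\<Sum>k<n. a k * g (x k)) \<le> B"
  shows "(\<lambda>n. infdist (x n) {y. V y = 0}) \<longlonglongrightarrow> 0"
proof -
  obtain v where v: "(\<lambda>n. V (x n)) \<longlonglongrightarrow> v" using conv by (auto simp: convergent_def)
  have v0: "0 \<le> v" by (rule LIMSEQ_le_const[OF v]) (use V0 in auto)
  obtain R where R: "\<And>y. R \<le> norm y \<Longrightarrow> v + 1 \<le> V y"
    using coercive unfolding filterlim_at_top eventually_at_infinity by blast
  have ev_ball: "eventually (\<lambda>n. x n \<in> cball 0 R) sequentially"
    using order_tendstoD(2)[OF v, of "v + 1"]
    by (auto elim!: eventually_mono) (metis R linorder_not_le nle_le)
  have "v = 0"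
  proof (rule ccontr)
    assume "v \<noteq> 0"
    with v0 have "0 < v" by simp
    have "closed {y. v / 2 \<le> V y}"
      using closed_Collect_le[of "\<lambda>_. v / 2" V] contV by auto
    then have "compact (cball 0 R \<inter> {y. v / 2 \<le> V y})"
      by (intro compact_Int_closed) auto
    moreover have "0 < g y" if "y \<in> cball 0 R \<inter> {y. v / 2 \<le> V y}" for y
      using that zeros[of y] g0[of y] \<open>0 < v\<close> by (cases "g y = 0") auto
    moreover have "continuous_on (cball 0 R \<inter> {y. v / 2 \<le> V y}) g"
      by (rule continuous_on_subset[OF contg]) auto
    ultimately obtain \<delta> where \<delta>: "0 < \<delta>" "\<And>y. y \<in> cball 0 R \<inter> {y. v / 2 \<le> V y} \<Longrightarrow> \<delta> \<le> g y"
      using pos_bounded_below_on_compact by blast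
    have "eventually (\<lambda>n. v / 2 < V (x n)) sequentially"
      using \<open>0 < v\<close> by (intro order_tendstoD(1)[OF v]) auto
    with ev_ball have "eventually (\<lambda>n. \<delta> \<le> g (x n)) sequentially"
      by eventually_elim (auto intro!: \<delta>(2))
    then obtain N where N: "\<And>n. N \<le> n \<Longrightarrow> \<delta> \<le> g (x n)"
      by (auto simp: eventually_sequentially)
    have le: "\<delta> * (\<Sum>k<n. a k) - \<delta> * (\<Sum>k<N. a k) \<le> B" if "N \<le> n" for n
    proof -
      have "\<delta> * (\<Sum>k<n. a k) - \<delta> * (\<Sum>k<N. a k) = (\<Sum>k=N..<n. a k * \<delta>)"
        using that sum_diff_nat_ivl[of 0 N n a]
        by (simp add: right_diff_distrib[symmetric] sum_distrib_left sum_distrib_right atLeast0LessThan mult.commute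
              flip: sum_distrib_left)
      also have "\<dots> \<le> (\<Sum>k=N..<n. a k * g (x k))"
        using N a0 by (intro sum_mono mult_left_mono) (auto simp: less_imp_le)
      also have "\<dots> \<le> (\<Sum>k<n. a k * g (x k))"
        using a0 g0 by (intro sum_mono2) (auto simp: less_imp_le)
      also have "\<dots> \<le> B" by (rule bdd)
      finally show ?thesis .
    qed
    have "eventually (\<lambda>n. (B + 1 + \<delta> * (\<Sum>k<N. a k)) / \<delta> \<le> (\<Sum>k<n. a k)) sequentially"
      using asum by (auto simp: filterlim_at_top)
    then obtain n where n: "N \<le> n" "(B + 1 + \<delta> * (\<Sum>k<N. a k)) / \<delta> \<le> (\<Sum>k<n. a k)"
      by (metis eventually_sequentially nle_le order_refl)
    then have "B + 1 + \<delta> * (\<Sum>k<N. a k) \<le> \<delta> * (\<Sum>k<n. a k)"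
      using \<delta>(1) by (simp add: pos_divide_le_eq mult.commute)
    with le[OF n(1)] show False by simp
  qed
  show ?thesis
  proof (rule order_tendstoI)
    fix e :: real assume "0 < e"
    let ?D = "cball 0 R \<inter> {y. e \<le> infdist y {y. V y = 0}}"
    have "closed {y. e \<le> infdist y {y. V y = 0}}"
      by (intro closed_Collect_le continuous_intros)
    then have "compact ?D" by (intro compact_Int_closed) auto
    moreover have "0 < V y" if "y \<in> ?D" for y
      using that V0[of y] \<open>0 < e\<close> by (cases "V y = 0") (auto simp: infdist_zero)
    moreover have "continuous_on ?D V"
      by (rule continuous_on_subset[OF contV]) auto
    ultimately obtain \<delta> where \<delta>: "0 < \<delta>" "\<And>y. y \<in> ?D \<Longrightarrow> \<delta> \<le> V y"
      using pos_bounded_below_on_compact by blast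
    have "eventually (\<lambda>n. V (x n) < \<delta>) sequentially"
      using order_tendstoD(2)[OF v] \<delta>(1) \<open>v = 0\<close> by auto
    with ev_ball show "eventually (\<lambda>n. infdist (x n) {y. V y = 0} < e) sequentially"
      by eventually_elim (use \<delta>(2) in force)
  qed (auto intro: always_eventually less_le_trans infdist_nonneg)
qed

section \<open>The Robbins--Siegmund theorem\<close>

text \<open>Dividing by \<open>p n = (\<Prod>k<n. 1 + b k)\<close> removes the factors \<open>1 + b n\<close>. Then both the quotient
\<open>U n / p n\<close> and its sum with the accumulated terms \<open>G k / p (k + 1)\<close> are nonnegative
supermartingales, so both converge; since \<open>p\<close> increases to a finite limit, convergence of \<open>U n\<close>
and boundedness of the sums of \<open>G k\<close> follow.\<close>
lemma robbins_siegmund: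
  assumes P: "prob_space P" and sub: "\<And>n. subalgebra P (F n)"
    and F_mono: "\<And>n. sets (F n) \<subseteq> sets (F (Suc n))"
    and U: "\<And>n. U n \<in> borel_measurable (F n)" and G: "\<And>n. G n \<in> borel_measurable (F n)"
    and intU: "\<And>n. integrable P (U n)" and intG: "\<And>n. integrable P (G n)"
    and U0: "\<And>n \<omega>. (0::real) \<le> U n \<omega>" and G0: "\<And>n \<omega>. (0::real) \<le> G n \<omega>"
    and b0: "\<And>n. 0 \<le> b n" and b: "summable b"
    and step: "\<And>n A. A \<in> sets (F n) \<Longrightarrow>
      (\<integral>\<omega>. indicator A \<omega> * U (Suc n) \<omega> \<partial>P)
        \<le> (1 + b n) * (\<integral>\<omega>. indicator A \<omega> * U n \<omega> \<partial>P) - (\<integral>\<omega>. indicator A \<omega> * G n \<omega> \<partial>P)"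
  shows "AE \<omega> in P. convergent (\<lambda>n. U n \<omega>) \<and> (\<exists>B. \<forall>n. (\<Sum>k<n. G k \<omega>) \<le> B)"
proof -
  \<comment> \<open>\<open>1 + b \<le> exp b\<close> turns the summability of \<open>b\<close> into a bound on the product.\<close>
  define p where "p n = (\<Prod>k<n. 1 + b k)" for n
  have p_Suc: "p (Suc n) = (1 + b n) * p n" for n by (simp add: p_def)
  have p1: "1 \<le> p n" for n unfolding p_def by (intro prod_ge_1) (use b0 in auto)
  have pos: "0 < p n" for n using p1[of n] by linarith
  define pmax where "pmax = exp (suminf b)"
  have p_le: "p n \<le> pmax" for n
  proof -
    have "p n \<le> (\<Prod>k<n. exp (b k))"
      unfolding p_def by (intro prod_mono) (use b0 in \<open>auto intro: exp_ge_add_one_self add_nonneg_nonneg\<close>)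
    also have "\<dots> = exp (\<Sum>k<n. b k)" by (simp add: exp_sum)
    also have "\<dots> \<le> pmax" unfolding pmax_def using b b0 by (auto intro: sum_le_suminf)
    finally show ?thesis .
  qed
  have "incseq p"
    by (rule incseq_SucI) (simp add: p_Suc b0 less_imp_le[OF pos] algebra_simps)
  then have conv_p: "convergent p"
    using incseq_convergent[of p pmax] p_le by (metis convergent_def)
  define W where "W n \<omega> = U n \<omega> / p n" for n \<omega>
  define Y where "Y n \<omega> = W n \<omega> + (\<Sum>k<n. G k \<omega> / p (Suc k))" for n \<omega>
  have W0: "0 \<le> W n \<omega>" for n \<omega> using U0 pos by (simp add: W_def less_imp_le)
  have Gp0: "0 \<le> G k \<omega> / p (Suc k)" for k \<omega> using G0 pos by (simp add: less_imp_le)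
  have Y0: "0 \<le> Y n \<omega>" for n \<omega> unfolding Y_def using W0 Gp0 by (intro add_nonneg_nonneg sum_nonneg)
  have intW: "integrable P (W n)" for n unfolding W_def using intU by auto
  have intY: "integrable P (Y n)" for n unfolding Y_def using intW intG by auto
  have W: "W n \<in> borel_measurable (F n)" for n
    unfolding W_def using U[of n] by simp
  have F_le: "sets (F k) \<subseteq> sets (F n)" if "k \<le> n" for k n
    using lift_Suc_mono_le[of "\<lambda>n. sets (F n)", OF F_mono that] .
  have G': "G k \<in> borel_measurable (F n)" if "k \<le> n" for k n
    by (rule measurable_from_subalg[OF _ G])
      (use F_le[OF that] sub in \<open>auto simp: subalgebra_def\<close>)
  have Y: "Y n \<in> borel_measurable (F n)" for n
    unfolding Y_def using W[of n] G'[of _ n]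
    by (intro borel_measurable_add borel_measurable_sum borel_measurable_divide) auto
  have AP: "A \<in> sets P" if "A \<in> sets (F n)" for A n using that sub[of n] by (auto simp: subalgebra_def)
  have int_ind: "integrable P (\<lambda>\<omega>. indicator A \<omega> * f \<omega>)"
    if "A \<in> sets (F n)" "integrable P f" for A n and f :: "'a \<Rightarrow> real"
    using integrable_mult_indicator[OF AP[OF that(1)] that(2)] by simp
  have stepW: "(\<integral>\<omega>. indicator A \<omega> * W (Suc n) \<omega> \<partial>P) + (\<integral>\<omega>. indicator A \<omega> * (G n \<omega> / p (Suc n)) \<partial>P)
      \<le> (\<integral>\<omega>. indicator A \<omega> * W n \<omega> \<partial>P)" if "A \<in> sets (F n)" for A n
  proof -
    have "(\<integral>\<omega>. indicator A \<omega> * U (Suc n) \<omega> \<partial>P) / p (Suc n)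
        \<le> ((1 + b n) * (\<integral>\<omega>. indicator A \<omega> * U n \<omega> \<partial>P) - (\<integral>\<omega>. indicator A \<omega> * G n \<omega> \<partial>P)) / p (Suc n)"
      by (rule divide_right_mono[OF step[OF that]]) (simp add: less_imp_le pos)
    also have "\<dots> = (\<integral>\<omega>. indicator A \<omega> * U n \<omega> \<partial>P) / p n - (\<integral>\<omega>. indicator A \<omega> * G n \<omega> \<partial>P) / p (Suc n)"
      using pos[of n] b0[of n] by (simp add: p_Suc diff_divide_distrib)
    finally show ?thesis by (simp add: W_def)
  qed
  have "AE \<omega> in P. convergent (\<lambda>n. W n \<omega>)"
  proof (rule nonneg_supermartingale_convergent[where F = F and Y = W, OF P sub F_mono W intW W0])
    fix n A assume A: "A \<in> sets (F n)"
    have "0 \<le> (\<integral>\<omega>. indicator A \<omega> * (G n \<omega> / p (Suc n)) \<partial>P)"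
      by (intro Bochner_Integration.integral_nonneg mult_nonneg_nonneg Gp0) auto
    then show "(\<integral>\<omega>. indicator A \<omega> * W (Suc n) \<omega> \<partial>P) \<le> (\<integral>\<omega>. indicator A \<omega> * W n \<omega> \<partial>P)"
      using stepW[OF A] by linarith
  qed
  moreover have "AE \<omega> in P. convergent (\<lambda>n. Y n \<omega>)"
  proof (rule nonneg_supermartingale_convergent[where F = F and Y = Y, OF P sub F_mono Y intY Y0])
    fix n A assume A: "A \<in> sets (F n)"
    let ?I = "\<lambda>f. \<integral>\<omega>. indicator A \<omega> * f \<omega> \<partial>P" and ?S = "\<lambda>\<omega>. \<Sum>k<n. G k \<omega> / p (Suc k)"
    have intS: "integrable P ?S" using intG by auto
    have intGn: "integrable P (\<lambda>\<omega>. G n \<omega> / p (Suc n))" using intG by auto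
    have "?I (Y (Suc n)) = ?I (W (Suc n)) + ?I (\<lambda>\<omega>. G n \<omega> / p (Suc n)) + ?I ?S"
      unfolding Y_def sum.lessThan_Suc distrib_left
      using int_ind[OF A intS] int_ind[OF A intGn] int_ind[OF A intW[of "Suc n"]]
      by (subst Bochner_Integration.integral_add, simp, simp, subst Bochner_Integration.integral_add) (simp_all only: ac_simps)
    also have "\<dots> \<le> ?I (W n) + ?I ?S"
      using stepW[OF A] by simp
    also have "\<dots> = ?I (Y n)"
      unfolding Y_def distrib_left
      using int_ind[OF A intS] int_ind[OF A intW[of n]] by (subst Bochner_Integration.integral_add) simp_all
    finally show "?I (Y (Suc n)) \<le> ?I (Y n)" .
  qed
  ultimately show ?thesis
  proof eventually_elim
    case (elim \<omega>)
    have "convergent (\<lambda>n. W n \<omega> * p n)" using elim(1) conv_p by (intro convergent_mult)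
    moreover have "W n \<omega> * p n = U n \<omega>" for n using pos[of n] by (simp add: W_def)
    ultimately have "convergent (\<lambda>n. U n \<omega>)" by simp
    moreover
    obtain B where B: "\<And>n. \<bar>Y n \<omega>\<bar> \<le> B"
      using convergent_imp_Bseq[OF elim(2)] by (auto simp: Bseq_def)
    have "(\<Sum>k<n. G k \<omega>) \<le> pmax * B" for n
    proof -
      have "G k \<omega> \<le> pmax * (G k \<omega> / p (Suc k))" for k
      proof -
        have "G k \<omega> = p (Suc k) * (G k \<omega> / p (Suc k))" using pos[of "Suc k"] by simp
        also have "\<dots> \<le> pmax * (G k \<omega> / p (Suc k))" by (rule mult_right_mono[OF p_le Gp0])
        finally show ?thesis .
      qed
      then have "(\<Sum>k<n. G k \<omega>) \<le> pmax * (\<Sum>k<n. G k \<omega> / p (Suc k))"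
        unfolding sum_distrib_left by (intro sum_mono)
      also have "\<dots> \<le> pmax * B"
        using B[of n] W0[of n \<omega>] by (intro mult_left_mono) (auto simp: Y_def pmax_def)
      finally show ?thesis .
    qed
    ultimately show ?case by blast
  qed
qed

section \<open>The conditional drift of the Lyapunov function\<close>

lemma sq_norm_add_le: "(norm (u + v))\<^sup>2 \<le> 2 * (norm u)\<^sup>2 + 2 * (norm (v::'a::real_inner))\<^sup>2"
proof -
  have "0 \<le> (norm (u - v))\<^sup>2" by simp
  then show ?thesis by (simp add: power2_norm_eq_inner inner_simps inner_commute)
qed

lemma abs_inner_le_sq_norms: "\<bar>u \<bullet> v\<bar> \<le> (norm u)\<^sup>2 + (norm (v::'a::real_inner))\<^sup>2"
proof -
  have "\<bar>u \<bullet> v\<bar> \<le> norm u * norm v" by (rule Cauchy_Schwarz_ineq2)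
  also have "\<dots> \<le> (norm u)\<^sup>2 + (norm v)\<^sup>2"
    using sum_squares_bound[of "norm u" "norm v"] mult_nonneg_nonneg[OF norm_ge_zero norm_ge_zero, of u v] by linarith
  finally show ?thesis .
qed

lemma sq_norm_le_if_lipschitz:
  fixes f :: "'a::real_normed_vector \<Rightarrow> 'b::real_inner"
  assumes "\<And>y z. norm (f y - f z) \<le> L * norm (y - z)"
  shows "(norm (f y))\<^sup>2 \<le> (2 * (norm (f 0))\<^sup>2 + 2 * L\<^sup>2) * (1 + (norm y)\<^sup>2)"
proof -
  have "(norm (f y - f 0))\<^sup>2 \<le> (L * norm (y - 0))\<^sup>2"
    by (rule power_mono[OF assms]) simp
  then have "(norm (f y))\<^sup>2 \<le> 2 * (norm (f 0))\<^sup>2 + 2 * (L\<^sup>2 * (norm y)\<^sup>2)"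
    using sq_norm_add_le[of "f 0" "f y - f 0"] by (simp add: power_mult_distrib)
  also have "\<dots> \<le> (2 * (norm (f 0))\<^sup>2 + 2 * L\<^sup>2) * (1 + (norm y)\<^sup>2)"
    by (simp add: algebra_simps)
  finally show ?thesis .
qed

text \<open>A factor known at the conditioning time does not destroy the vanishing mean of the noise. This
is the componentwise version of pulling out known factors, integrability of the components being
inherited from the product of the norms.\<close>
lemma integral_inner_martingale_difference:
  fixes Z X :: "'w \<Rightarrow> real ^ 'd"
  assumes P: "prob_space P" and sub: "subalgebra P F"
    and Z: "Z \<in> borel_measurable F" and X: "X \<in> borel_measurable P"
    and int: "integrable P (\<lambda>\<omega>. norm (Z \<omega>) * norm (X \<omega>))"
    and mds: "AE \<omega> in P. vec_cond_exp P F X \<omega> = 0"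
  shows "integrable P (\<lambda>\<omega>. Z \<omega> \<bullet> X \<omega>)" "(\<integral>\<omega>. Z \<omega> \<bullet> X \<omega> \<partial>P) = 0"
proof -
  interpret prob_space P by fact
  interpret finite_measure_subalgebra P F by unfold_locales fact
  have ZP: "Z \<in> borel_measurable P" by (rule measurable_from_subalg[OF sub Z])
  have [measurable]: "(\<lambda>\<omega>. Z \<omega> $ i) \<in> borel_measurable P" "(\<lambda>\<omega>. X \<omega> $ i) \<in> borel_measurable P"
    "(\<lambda>\<omega>. Z \<omega> $ i) \<in> borel_measurable F" for i
    by (rule measurable_compose[OF _ borel_measurable_continuous_onI], rule ZP X Z,
        intro continuous_intros)+
  have inti: "integrable P (\<lambda>\<omega>. Z \<omega> $ i * X \<omega> $ i)" for i
  proof (rule Bochner_Integration.integrable_bound[OF int])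
    show "AE \<omega> in P. norm (Z \<omega> $ i * X \<omega> $ i) \<le> norm (norm (Z \<omega>) * norm (X \<omega>))"
      by (auto simp: abs_mult intro!: AE_I2 mult_mono component_le_norm_cart)
  qed simp
  have 0: "(\<integral>\<omega>. Z \<omega> $ i * X \<omega> $ i \<partial>P) = 0" for i
  proof -
    have "(\<integral>\<omega>. Z \<omega> $ i * X \<omega> $ i \<partial>P) = (\<integral>\<omega>. Z \<omega> $ i * real_cond_exp P F (\<lambda>w. X w $ i) \<omega> \<partial>P)"
      by (rule real_cond_exp_intg(2)[symmetric]) (use inti in auto)
    also have "\<dots> = (\<integral>\<omega>. 0 \<partial>P)"
    proof (rule integral_cong_AE)
      show "AE \<omega> in P. Z \<omega> $ i * real_cond_exp P F (\<lambda>w. X w $ i) \<omega> = 0"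
        using mds by eventually_elim (auto simp: vec_cond_exp_def vec_eq_iff)
    qed auto
    finally show ?thesis by simp
  qed
  show "integrable P (\<lambda>\<omega>. Z \<omega> \<bullet> X \<omega>)"
    unfolding inner_vec_def using inti by simp
  show "(\<integral>\<omega>. Z \<omega> \<bullet> X \<omega> \<partial>P) = 0"
    unfolding inner_vec_def using inti 0 by simp
qed

lemma integral_mult_le_cond_exp_bound:
  fixes w q f :: "'w \<Rightarrow> real"
  assumes P: "prob_space P" and sub: "subalgebra P F"
    and w: "w \<in> borel_measurable F" "\<And>\<omega>. 0 \<le> w \<omega>"
    and f: "f \<in> borel_measurable P" and int: "integrable P (\<lambda>\<omega>. w \<omega> * f \<omega>)"
    and intq: "integrable P (\<lambda>\<omega>. w \<omega> * q \<omega>)"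
    and le: "AE \<omega> in P. real_cond_exp P F f \<omega> \<le> q \<omega>"
  shows "(\<integral>\<omega>. w \<omega> * f \<omega> \<partial>P) \<le> (\<integral>\<omega>. w \<omega> * q \<omega> \<partial>P)"
proof -
  interpret prob_space P by fact
  interpret finite_measure_subalgebra P F by unfold_locales fact
  have "(\<integral>\<omega>. w \<omega> * f \<omega> \<partial>P) = (\<integral>\<omega>. w \<omega> * real_cond_exp P F f \<omega> \<partial>P)"
    by (rule real_cond_exp_intg(2)[symmetric, OF int w(1) f])
  also have "\<dots> \<le> (\<integral>\<omega>. w \<omega> * q \<omega> \<partial>P)"
    by (rule integral_mono_AE[OF real_cond_exp_intg(1)[OF int w(1) f] intq])
      (use le in eventually_elim, simp add: w mult_left_mono)
  finally show ?thesis .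
qed

text \<open>Integrated form of the one-step inequality for
\<open>1 + V\<close>; with \<open>w\<close> the product of the weight and the indicator of a set of \<open>F\<close> it says the
same as a conditional inequality. The constant arises as follows: \<open>K (norm (\<alpha> (h + X)))\<^sup>2\<close> is at
most \<open>2 K \<alpha>\<^sup>2 ((norm h)\<^sup>2 + (norm X)\<^sup>2)\<close>, and each of the two squares has weighted mean at most \<open>D\<close>
times that of \<open>1 + V\<close>. Integrability is part of the claim, as it carries over from one step of the
iteration to the next.\<close>
lemma expected_lyapunov_step:
  fixes V :: "real ^ 'd \<Rightarrow> real" and G h :: "real ^ 'd \<Rightarrow> real ^ 'd" and y X :: "'w \<Rightarrow> real ^ 'd"
  assumes P: "prob_space P" and sub: "subalgebra P F"
    and y: "y \<in> borel_measurable F" and X: "X \<in> borel_measurable P"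
    and X2: "integrable P (\<lambda>\<omega>. (norm (X \<omega>))\<^sup>2)"
    and mds: "AE \<omega> in P. vec_cond_exp P F X \<omega> = 0"
    and var: "AE \<omega> in P. real_cond_exp P F (\<lambda>\<omega>. (norm (X \<omega>))\<^sup>2) \<omega> \<le> D * (1 + V (y \<omega>))"
    and contV: "continuous_on UNIV V" and contG: "continuous_on UNIV G" and conth: "continuous_on UNIV h"
    and V0: "\<And>z. 0 \<le> V z" and K0: "0 \<le> K"
    and taylor: "\<And>z u. V (z + u) \<le> V z + G z \<bullet> u + K * (norm u)\<^sup>2"
    and G_le: "\<And>z. (norm (G z))\<^sup>2 \<le> D * (1 + V z)"
    and h_le: "\<And>z. (norm (h z))\<^sup>2 \<le> D * (1 + V z)"
    and w: "w \<in> borel_measurable F" "\<And>\<omega>. 0 \<le> w \<omega>" "\<And>\<omega>. w \<omega> \<le> 1"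
    and int: "integrable P (\<lambda>\<omega>. w \<omega> * (1 + V (y \<omega>)))"
  shows "integrable P (\<lambda>\<omega>. w \<omega> * (G (y \<omega>) \<bullet> h (y \<omega>)))"
    and "integrable P (\<lambda>\<omega>. w \<omega> * (1 + V (y \<omega> + \<alpha> *\<^sub>R (h (y \<omega>) + X \<omega>))))"
    and "(\<integral>\<omega>. w \<omega> * (1 + V (y \<omega> + \<alpha> *\<^sub>R (h (y \<omega>) + X \<omega>))) \<partial>P)
      \<le> (1 + 4 * K * D * \<alpha>\<^sup>2) * (\<integral>\<omega>. w \<omega> * (1 + V (y \<omega>)) \<partial>P)
        + \<alpha> * (\<integral>\<omega>. w \<omega> * (G (y \<omega>) \<bullet> h (y \<omega>)) \<partial>P)"
proof -
  interpret prob_space P by fact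
  note [measurable] = borel_measurable_continuous_onI[OF contV]
    borel_measurable_continuous_onI[OF contG] borel_measurable_continuous_onI[OF conth]
  note [measurable] = y w(1) X
  have yP[measurable]: "y \<in> borel_measurable P" and wP[measurable]: "w \<in> borel_measurable P"
    using measurable_from_subalg[OF sub y] measurable_from_subalg[OF sub w(1)] .
  let ?v = "\<lambda>\<omega>. w \<omega> * (1 + V (y \<omega>))"
  have wX: "integrable P (\<lambda>\<omega>. w \<omega> * (norm (X \<omega>))\<^sup>2)"
    by (rule Bochner_Integration.integrable_bound[OF X2])
      (auto simp: w abs_mult intro!: mult_left_le_one_le)
  have wGh: "\<bar>w \<omega> * (G (y \<omega>) \<bullet> h (y \<omega>))\<bar> \<le> 2 * D * ?v \<omega>" for \<omega>
  proof -
    have "\<bar>G (y \<omega>) \<bullet> h (y \<omega>)\<bar> \<le> 2 * D * (1 + V (y \<omega>))"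
      using abs_inner_le_sq_norms[of "G (y \<omega>)" "h (y \<omega>)"] G_le[of "y \<omega>"] h_le[of "y \<omega>"] by linarith
    from mult_left_mono[OF this w(2)[of \<omega>]] show ?thesis by (simp add: abs_mult w mult_ac)
  qed
  show i1: "integrable P (\<lambda>\<omega>. w \<omega> * (G (y \<omega>) \<bullet> h (y \<omega>)))"
    by (rule Bochner_Integration.integrable_bound[where f = "\<lambda>\<omega>. 2 * D * ?v \<omega>"])
      (use int wGh in \<open>auto intro!: AE_I2 order_trans[OF _ abs_ge_self]\<close>)
  have intN: "integrable P (\<lambda>\<omega>. norm (w \<omega> *\<^sub>R G (y \<omega>)) * norm (X \<omega>))"
  proof (rule Bochner_Integration.integrable_bound[where f = "\<lambda>\<omega>. D * ?v \<omega> + w \<omega> * (norm (X \<omega>))\<^sup>2"])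
    have "norm (G z) * norm u \<le> (norm (G z))\<^sup>2 + (norm u)\<^sup>2" for z u
      using sum_squares_bound[of "norm (G z)" "norm u"] mult_nonneg_nonneg[OF norm_ge_zero norm_ge_zero, of "G z" u]
      by linarith
    then have "norm (G (y \<omega>)) * norm (X \<omega>) \<le> D * (1 + V (y \<omega>)) + (norm (X \<omega>))\<^sup>2" for \<omega>
      using G_le[of "y \<omega>"] by (meson add_right_mono order_trans)
    from mult_left_mono[OF this w(2)]
    show "AE \<omega> in P. norm (norm (w \<omega> *\<^sub>R G (y \<omega>)) * norm (X \<omega>)) \<le> norm (D * ?v \<omega> + w \<omega> * (norm (X \<omega>))\<^sup>2)"
      by (intro AE_I2) (auto simp: w abs_mult algebra_simps intro!: order_trans[OF _ abs_ge_self])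
  qed (use int wX in auto)
  have Z: "(\<lambda>\<omega>. w \<omega> *\<^sub>R G (y \<omega>)) \<in> borel_measurable F" by measurable
  note noise = integral_inner_martingale_difference[OF P sub Z X intN mds]
  \<comment> \<open>Taylor's bound after expanding the square, split into the terms that are integrated separately.\<close>
  let ?B = "\<lambda>\<omega>. ?v \<omega> + \<alpha> * (w \<omega> * (G (y \<omega>) \<bullet> h (y \<omega>))) + \<alpha> * ((w \<omega> *\<^sub>R G (y \<omega>)) \<bullet> X \<omega>)
      + (2 * K * \<alpha>\<^sup>2 * D) * ?v \<omega> + (2 * K * \<alpha>\<^sup>2) * (w \<omega> * (norm (X \<omega>))\<^sup>2)"
  have intB: "integrable P ?B"
    using int i1 noise(1) wX by (intro Bochner_Integration.integrable_add integrable_mult_right) auto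
  have le: "w \<omega> * (1 + V (y \<omega> + \<alpha> *\<^sub>R (h (y \<omega>) + X \<omega>))) \<le> ?B \<omega>" for \<omega>
  proof -
    have "(norm (\<alpha> *\<^sub>R (h (y \<omega>) + X \<omega>)))\<^sup>2 = \<alpha>\<^sup>2 * (norm (h (y \<omega>) + X \<omega>))\<^sup>2"
      by (simp add: power_mult_distrib)
    also have "\<dots> \<le> \<alpha>\<^sup>2 * (2 * (D * (1 + V (y \<omega>))) + 2 * (norm (X \<omega>))\<^sup>2)"
      using sq_norm_add_le[of "h (y \<omega>)" "X \<omega>"] h_le[of "y \<omega>"] by (intro mult_left_mono) auto
    finally have "K * (norm (\<alpha> *\<^sub>R (h (y \<omega>) + X \<omega>)))\<^sup>2
        \<le> K * (\<alpha>\<^sup>2 * (2 * (D * (1 + V (y \<omega>))) + 2 * (norm (X \<omega>))\<^sup>2))"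
      using K0 by (rule mult_left_mono)
    then have "1 + V (y \<omega> + \<alpha> *\<^sub>R (h (y \<omega>) + X \<omega>)) \<le> 1 + V (y \<omega>) + \<alpha> * (G (y \<omega>) \<bullet> h (y \<omega>)) + \<alpha> * (G (y \<omega>) \<bullet> X \<omega>)
       + K * (\<alpha>\<^sup>2 * (2 * (D * (1 + V (y \<omega>))) + 2 * (norm (X \<omega>))\<^sup>2))"
      using taylor[of "y \<omega>" "\<alpha> *\<^sub>R (h (y \<omega>) + X \<omega>)"] by (simp add: inner_add_right distrib_left)
    from mult_left_mono[OF this w(2)[of \<omega>]] show ?thesis by (simp add: algebra_simps)
  qed
  have nn: "0 \<le> w \<omega> * (1 + V z)" for \<omega> z by (simp add: w V0)
  show i2: "integrable P (\<lambda>\<omega>. w \<omega> * (1 + V (y \<omega> + \<alpha> *\<^sub>R (h (y \<omega>) + X \<omega>))))"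
    by (rule Bochner_Integration.integrable_bound[OF intB])
      (measurable, unfold real_norm_def abs_of_nonneg[OF nn], intro AE_I2 order_trans[OF le abs_ge_self])
  have var': "(\<integral>\<omega>. w \<omega> * (norm (X \<omega>))\<^sup>2 \<partial>P) \<le> D * (\<integral>\<omega>. ?v \<omega> \<partial>P)"
  proof -
    have "(\<integral>\<omega>. w \<omega> * (norm (X \<omega>))\<^sup>2 \<partial>P) \<le> (\<integral>\<omega>. w \<omega> * (D * (1 + V (y \<omega>))) \<partial>P)"
      by (rule integral_mult_le_cond_exp_bound[OF P sub w(1,2) _ wX _ var])
        (use int integrable_mult_right[OF int, of D] in \<open>auto simp: mult_ac\<close>)
    also have "\<dots> = (\<integral>\<omega>. D * ?v \<omega> \<partial>P)" by (simp only: mult_ac)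
    finally show ?thesis by simp
  qed
  have "(\<integral>\<omega>. w \<omega> * (1 + V (y \<omega> + \<alpha> *\<^sub>R (h (y \<omega>) + X \<omega>))) \<partial>P) \<le> (\<integral>\<omega>. ?B \<omega> \<partial>P)"
    by (rule integral_mono[OF i2 intB le])
  also have "\<dots> = (\<integral>\<omega>. ?v \<omega> \<partial>P) + \<alpha> * (\<integral>\<omega>. w \<omega> * (G (y \<omega>) \<bullet> h (y \<omega>)) \<partial>P)
      + \<alpha> * (\<integral>\<omega>. (w \<omega> *\<^sub>R G (y \<omega>)) \<bullet> X \<omega> \<partial>P)
      + (2 * K * \<alpha>\<^sup>2 * D) * (\<integral>\<omega>. ?v \<omega> \<partial>P) + (2 * K * \<alpha>\<^sup>2) * (\<integral>\<omega>. w \<omega> * (norm (X \<omega>))\<^sup>2 \<partial>P)"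
    using int i1 noise(1) wX
    by (simp only: Bochner_Integration.integral_add Bochner_Integration.integrable_add
        integrable_mult_right integral_mult_right_zero)
  also have "\<dots> \<le> (\<integral>\<omega>. ?v \<omega> \<partial>P) + \<alpha> * (\<integral>\<omega>. w \<omega> * (G (y \<omega>) \<bullet> h (y \<omega>)) \<partial>P)
      + \<alpha> * 0
      + (2 * K * \<alpha>\<^sup>2 * D) * (\<integral>\<omega>. ?v \<omega> \<partial>P) + (2 * K * \<alpha>\<^sup>2) * (D * (\<integral>\<omega>. ?v \<omega> \<partial>P))"
    unfolding noise(2) using K0 by (intro add_mono mult_left_mono var' order_refl) auto
  also have "\<dots> = (1 + 4 * K * D * \<alpha>\<^sup>2) * (\<integral>\<omega>. ?v \<omega> \<partial>P) + \<alpha> * (\<integral>\<omega>. w \<omega> * (G (y \<omega>) \<bullet> h (y \<omega>)) \<partial>P)"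
    by (simp add: algebra_simps)
  finally show "(\<integral>\<omega>. w \<omega> * (1 + V (y \<omega> + \<alpha> *\<^sub>R (h (y \<omega>) + X \<omega>))) \<partial>P)
      \<le> (1 + 4 * K * D * \<alpha>\<^sup>2) * (\<integral>\<omega>. ?v \<omega> \<partial>P) + \<alpha> * (\<integral>\<omega>. w \<omega> * (G (y \<omega>) \<bullet> h (y \<omega>)) \<partial>P)" .
qed

section \<open>The filtration generated by the noise\<close>

lemma space_noise_filtration [simp]: "space (noise_filtration P x0 M n) = space P"
  by (simp add: noise_filtration_def space_measure_of_conv)

lemma sets_noise_filtration:
  "sets (noise_filtration P x0 M n) = sigma_sets (space P)
       ({x0 -` A \<inter> space P | A. A \<in> sets borel} \<union>
        {M k -` A \<inter> space P | k A. k \<in> {1..n} \<and> A \<in> sets borel})"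
  unfolding noise_filtration_def by (rule sets_measure_of) auto

lemma subalgebra_noise_filtration:
  assumes "x0 \<in> borel_measurable P" "\<And>k. 1 \<le> k \<Longrightarrow> M k \<in> borel_measurable P"
  shows "subalgebra P (noise_filtration P x0 M n)"
  unfolding subalgebra_def sets_noise_filtration
  using assms by (auto intro!: sets.sigma_sets_subset measurable_sets)

lemma noise_filtration_mono:
  "sets (noise_filtration P x0 M n) \<subseteq> sets (noise_filtration P x0 M (Suc n))"
proof -
  have "{1..n} \<subseteq> {1..Suc n}" by auto
  then show ?thesis
    unfolding sets_noise_filtration by (intro sigma_sets_mono' Un_mono order_refl) blast
qed

lemma measurable_noise_filtration_initial:
  "x0 \<in> borel_measurable (noise_filtration P x0 M n)"
  by (rule measurableI) (auto simp: sets_noise_filtration intro!: sigma_sets.Basic)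

lemma measurable_noise_filtration_noise:
  assumes "1 \<le> k" "k \<le> n"
  shows "M k \<in> borel_measurable (noise_filtration P x0 M n)"
  by (rule measurableI) (use assms in \<open>auto simp: sets_noise_filtration intro!: sigma_sets.Basic\<close>)

section \<open>Almost sure convergence to the zeros of the Lyapunov function\<close>

theorem corollary4:
  fixes P :: "'w measure"
    and h :: "real ^ 'd \<Rightarrow> real ^ 'd"
    and a :: "nat \<Rightarrow> real"
    and x M :: "nat \<Rightarrow> 'w \<Rightarrow> real ^ 'd"
    and V :: "real ^ 'd \<Rightarrow> real"
    and H :: "(real ^ 'd) set"
  assumes prob: "prob_space P"
    and x0_meas: "x 0 \<in> borel_measurable P"
    and iterates: "\<And>n \<omega>. \<omega> \<in> space P \<Longrightarrow>
          x (Suc n) \<omega> = x n \<omega> + a n *\<^sub>R (h (x n \<omega>) + M (Suc n) \<omega>)"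
    and V_nonneg: "\<And>y. 0 \<le> V y"
    and V_diff: "\<And>y. V differentiable (at y)"
    and V_coercive: "filterlim V at_top at_infinity"
    and V_descent: "\<And>y. grad V y \<bullet> h y \<le> 0"
    and H_def: "H = {y. grad V y \<bullet> h y = 0}"
    and H_zero: "H = {y. V y = 0}"
    and A1: "\<exists>L. L-lipschitz_on UNIV h"
    and A2_pos: "\<And>n. 0 < a n"
    and A2_sum: "filterlim (\<lambda>n. \<Sum>k<n. a k) at_top sequentially"
    and A2_sum_sq: "summable (\<lambda>n. (a n)\<^sup>2)"
    and A2_mono: "\<exists>c>0. \<forall>m n. m \<le> n \<longrightarrow> a n \<le> c * a m"
    and A3_meas: "\<And>n. 1 \<le> n \<Longrightarrow> M n \<in> borel_measurable P"
    and A3_sq_int: "\<And>n. 1 \<le> n \<Longrightarrow> integrable P (\<lambda>\<omega>. (norm (M n \<omega>))\<^sup>2)"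
    and A3_mds: "\<And>n. AE \<omega> in P.
          vec_cond_exp P (noise_filtration P (x 0) M n) (M (Suc n)) \<omega> = 0"
    and A3_var: "\<exists>c>0. \<forall>n. AE \<omega> in P.
          real_cond_exp P (noise_filtration P (x 0) M n) (\<lambda>w. (norm (M (Suc n) w))\<^sup>2) \<omega>
            \<le> c * (1 + (norm (x n \<omega>))\<^sup>2)"
    and A4_diff: "\<And>y. grad V differentiable (at y)"
    and A4_bound: "\<exists>c>0. \<forall>i j y. \<bar>partial_deriv i (partial_deriv j V) y\<bar> < c"
    and A5: "\<exists>c>0. \<forall>y. (norm y)\<^sup>2 < c * (1 + V y)"
  shows "\<P>(\<omega> in P. (\<lambda>n. infdist (x n \<omega>) H) \<longlonglongrightarrow> 0) = 1"
proof -
  interpret prob_space P by (rule prob)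
  define F where "F n = noise_filtration P (x 0) M n" for n
  have sub: "subalgebra P (F n)" for n
    unfolding F_def by (rule subalgebra_noise_filtration[OF x0_meas A3_meas])
  have F_mono: "sets (F n) \<subseteq> sets (F (Suc n))" for n
    unfolding F_def by (rule noise_filtration_mono)
  have spF: "space (F n) = space P" for n by (simp add: F_def)

  obtain L where L: "L-lipschitz_on UNIV h" using A1 by blast
  have h_lip: "norm (h y - h z) \<le> L * norm (y - z)" for y z
    using lipschitz_onD[OF L, of y z] by (simp add: dist_norm)
  have conth: "continuous_on UNIV h" by (rule lipschitz_on_continuous_on[OF L])
  have contV: "continuous_on UNIV V"
    by (intro continuous_at_imp_continuous_on ballI differentiable_imp_continuous_within V_diff)
  have contG: "continuous_on UNIV (grad V)"
    by (intro continuous_at_imp_continuous_on ballI differentiable_imp_continuous_within A4_diff)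
  obtain c4 where c4: "0 < c4" "\<And>i j y. \<bar>partial_deriv i (partial_deriv j V) y\<bar> < c4"
    using A4_bound by blast
  define K where "K = real CARD('d) * real CARD('d) * c4"
  have K0: "0 \<le> K" using c4(1) by (simp add: K_def)
  have G_lip: "norm (grad V y - grad V z) \<le> K * norm (y - z)" for y z
    unfolding K_def by (rule grad_lipschitz[OF A4_diff less_imp_le[OF c4(2)]])
  have taylor: "V (z + u) \<le> V z + grad V z \<bullet> u + K * (norm u)\<^sup>2" for z u
    by (rule quadratic_upper_bound[OF has_derivative_grad[OF V_diff] G_lip])

  obtain c3 where c3: "0 < c3" "\<And>n. AE \<omega> in P.
      real_cond_exp P (F n) (\<lambda>w. (norm (M (Suc n) w))\<^sup>2) \<omega> \<le> c3 * (1 + (norm (x n \<omega>))\<^sup>2)"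
    using A3_var unfolding F_def by blast
  obtain c5 where c5: "0 < c5" "\<And>y. (norm y)\<^sup>2 < c5 * (1 + V y)" using A5 by blast
  \<comment> \<open>One constant for all growth bounds: \<open>Cg\<close> and \<open>Ch\<close> bound the squared norms of \<open>grad V\<close> and \<open>h\<close>, \<open>c3\<close>
      the noise, each relative to \<open>1 + (norm z)\<^sup>2\<close>, which is at most \<open>(1 + c5) (1 + V z)\<close>.\<close>
  define Cg where "Cg = 2 * (norm (grad V 0))\<^sup>2 + 2 * K\<^sup>2"
  define Ch where "Ch = 2 * (norm (h 0))\<^sup>2 + 2 * L\<^sup>2"
  define D where "D = (Cg + Ch + c3) * (1 + c5)"
  have C0: "0 \<le> Cg" "0 \<le> Ch" by (auto simp: Cg_def Ch_def)
  have D_bound: "q \<le> D * (1 + V z)" if "q \<le> C * (1 + (norm z)\<^sup>2)" "C \<le> Cg + Ch + c3" for q C z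
  proof -
    have "q \<le> (Cg + Ch + c3) * (1 + (norm z)\<^sup>2)"
      using that by (meson add_nonneg_nonneg mult_right_mono order_trans zero_le_one zero_le_power2)
    also have "1 + (norm z)\<^sup>2 \<le> (1 + c5) * (1 + V z)"
      using c5(2)[of z] V_nonneg[of z] by (simp add: algebra_simps)
    then have "(Cg + Ch + c3) * (1 + (norm z)\<^sup>2) \<le> (Cg + Ch + c3) * ((1 + c5) * (1 + V z))"
      using C0 c3(1) by (intro mult_left_mono) auto
    finally show ?thesis by (simp add: D_def mult.assoc)
  qed
  have G_le: "(norm (grad V z))\<^sup>2 \<le> D * (1 + V z)" for z
    using sq_norm_le_if_lipschitz[OF G_lip, of z] C0 c3(1) by (intro D_bound[of _ Cg]) (auto simp: Cg_def)
  have h_le: "(norm (h z))\<^sup>2 \<le> D * (1 + V z)" for z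
    using sq_norm_le_if_lipschitz[OF h_lip, of z] C0 c3(1) by (intro D_bound[of _ Ch]) (auto simp: Ch_def)
  have var: "AE \<omega> in P. real_cond_exp P (F n) (\<lambda>\<omega>. (norm (M (Suc n) \<omega>))\<^sup>2) \<omega> \<le> D * (1 + V (x n \<omega>))" for n
    using c3(2)[of n] by eventually_elim (rule D_bound[of _ c3], use C0 in auto)
  have D0: "0 \<le> D" using C0 c3(1) c5(1) by (simp add: D_def)

  note [measurable] = borel_measurable_continuous_onI[OF contV]
    borel_measurable_continuous_onI[OF contG] borel_measurable_continuous_onI[OF conth]
  have xF[measurable]: "x n \<in> borel_measurable (F n)" for n
  proof (induction n)
    case 0
    then show ?case unfolding F_def by (rule measurable_noise_filtration_initial)
  next
    case (Suc n)
    have [measurable]: "x n \<in> borel_measurable (F (Suc n))"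
      by (rule measurable_from_subalg[OF _ Suc]) (use F_mono spF in \<open>auto simp: subalgebra_def\<close>)
    have [measurable]: "M (Suc n) \<in> borel_measurable (F (Suc n))"
      unfolding F_def by (rule measurable_noise_filtration_noise) auto
    have "(\<lambda>\<omega>. x n \<omega> + a n *\<^sub>R (h (x n \<omega>) + M (Suc n) \<omega>)) \<in> borel_measurable (F (Suc n))"
      by measurable
    then show ?case
      by (subst measurable_cong[OF iterates]) (auto simp: spF)
  qed
  have x0F: "x 0 \<in> borel_measurable (F n)" for n
    unfolding F_def by (rule measurable_noise_filtration_initial)
  have xP[measurable]: "x n \<in> borel_measurable P" for n
    by (rule measurable_from_subalg[OF sub xF])

  \<comment> \<open>The weight compensates for a possibly non-integrable \<open>V (x 0)\<close>.\<close>
  define w where "w \<omega> = 1 / (1 + V (x 0 \<omega>))" for \<omega>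
  have w_pos: "0 < w \<omega>" and w_le: "w \<omega> \<le> 1" for \<omega>
    using V_nonneg[of "x 0 \<omega>"] by (auto simp: w_def)
  have wF: "w \<in> borel_measurable (F n)" for n
    unfolding w_def using x0F[of n] by measurable
  define g where "g z = - (grad V z \<bullet> h z)" for z
  have g0: "0 \<le> g z" for z using V_descent[of z] by (simp add: g_def)
  have contg: "continuous_on UNIV g"
    unfolding g_def by (intro continuous_intros contG conth)
  define U where "U n \<omega> = w \<omega> * (1 + V (x n \<omega>))" for n \<omega>
  define S where "S n \<omega> = a n * (w \<omega> * g (x n \<omega>))" for n \<omega>
  have one_step: "integrable P (\<lambda>\<omega>. u \<omega> * g (x n \<omega>))"
      "integrable P (\<lambda>\<omega>. u \<omega> * (1 + V (x (Suc n) \<omega>)))"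
      "(\<integral>\<omega>. u \<omega> * (1 + V (x (Suc n) \<omega>)) \<partial>P)
        \<le> (1 + 4 * K * D * (a n)\<^sup>2) * (\<integral>\<omega>. u \<omega> * (1 + V (x n \<omega>)) \<partial>P) - a n * (\<integral>\<omega>. u \<omega> * g (x n \<omega>) \<partial>P)"
    if u: "u \<in> borel_measurable (F n)" "\<And>\<omega>. 0 \<le> u \<omega>" "\<And>\<omega>. u \<omega> \<le> 1"
      and int: "integrable P (\<lambda>\<omega>. u \<omega> * (1 + V (x n \<omega>)))" for u n
  proof -
    have mds: "AE \<omega> in P. vec_cond_exp P (F n) (M (Suc n)) \<omega> = 0"
      unfolding F_def by (rule A3_mds)
    have XP: "M (Suc n) \<in> borel_measurable P" and X2: "integrable P (\<lambda>\<omega>. (norm (M (Suc n) \<omega>))\<^sup>2)"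
      by (simp_all add: A3_meas A3_sq_int)
    note step = expected_lyapunov_step[where V = V and G = "grad V" and h = h and w = u
        and y = "x n" and X = "M (Suc n)" and D = D and K = K,
      OF prob sub xF[of n] XP X2 mds var contV contG conth V_nonneg K0 taylor G_le h_le u int]
    show "integrable P (\<lambda>\<omega>. u \<omega> * g (x n \<omega>))" using step(1) by (simp add: g_def)
    have eq: "u \<omega> * (1 + V (x (Suc n) \<omega>)) = u \<omega> * (1 + V (x n \<omega> + a n *\<^sub>R (h (x n \<omega>) + M (Suc n) \<omega>)))"
      if "\<omega> \<in> space P" for \<omega> using iterates[OF that] by simp
    show "integrable P (\<lambda>\<omega>. u \<omega> * (1 + V (x (Suc n) \<omega>)))"
      using step(2)[of "a n"] by (subst Bochner_Integration.integrable_cong[OF refl eq])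
    show "(\<integral>\<omega>. u \<omega> * (1 + V (x (Suc n) \<omega>)) \<partial>P)
        \<le> (1 + 4 * K * D * (a n)\<^sup>2) * (\<integral>\<omega>. u \<omega> * (1 + V (x n \<omega>)) \<partial>P) - a n * (\<integral>\<omega>. u \<omega> * g (x n \<omega>) \<partial>P)"
      using step(3)[of "a n"] by (subst Bochner_Integration.integral_cong[OF refl eq]) (simp_all add: g_def)
  qed
  have intU: "integrable P (U n)" for n
  proof (induction n)
    case 0
    have "U 0 = (\<lambda>_. 1)"
    proof
      show "U 0 \<omega> = 1" for \<omega> using w_pos[of \<omega>] by (simp add: U_def w_def)
    qed
    then show ?case by simp
  next
    case (Suc n)
    then show ?case unfolding U_def
      by (intro one_step(2) wF) (auto simp: w_le less_imp_le[OF w_pos])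
  qed
  have intwg: "integrable P (\<lambda>\<omega>. w \<omega> * g (x n \<omega>))" for n
    using intU[of n] unfolding U_def
    by (intro one_step(1) wF) (auto simp: w_le less_imp_le[OF w_pos])
  have "AE \<omega> in P. convergent (\<lambda>n. U n \<omega>) \<and> (\<exists>B. \<forall>n. (\<Sum>k<n. S k \<omega>) \<le> B)"
  proof (rule robbins_siegmund[where F = F and b = "\<lambda>n. 4 * K * D * (a n)\<^sup>2", OF prob sub F_mono])
    show "U n \<in> borel_measurable (F n)" for n
      unfolding U_def using wF[of n] by measurable
    show "S n \<in> borel_measurable (F n)" for n
      unfolding S_def g_def using wF[of n] by measurable
    show "integrable P (U n)" for n by (rule intU)
    show "integrable P (S n)" for n unfolding S_def using intwg by auto
    show "0 \<le> U n \<omega>" for n \<omega> unfolding U_def using w_pos[of \<omega>] V_nonneg[of "x n \<omega>"] by auto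
    show "0 \<le> S n \<omega>" for n \<omega> unfolding S_def using w_pos[of \<omega>] A2_pos[of n] g0[of "x n \<omega>"] by auto
    show "0 \<le> 4 * K * D * (a n)\<^sup>2" for n using K0 D0 by auto
    show "summable (\<lambda>n. 4 * K * D * (a n)\<^sup>2)" by (rule summable_mult[OF A2_sum_sq])
    fix n A assume A: "A \<in> sets (F n)"
    then have AP: "A \<in> sets P" using sub[of n] by (auto simp: subalgebra_def)
    \<comment> \<open>The supermartingale inequality on \<open>A\<close> is the one-step bound for the weight cut down to \<open>A\<close>.\<close>
    define u where "u \<omega> = indicator A \<omega> * w \<omega>" for \<omega>
    have "u \<in> borel_measurable (F n)" unfolding u_def using A wF[of n] by measurable
    moreover have "0 \<le> u \<omega>" "u \<omega> \<le> 1" for \<omega>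
      using w_pos[of \<omega>] w_le[of \<omega>] by (auto simp: u_def indicator_def)
    moreover have "integrable P (\<lambda>\<omega>. u \<omega> * (1 + V (x n \<omega>)))"
      using integrable_mult_indicator[OF AP intU[of n]] by (simp add: u_def U_def mult.assoc)
    ultimately have "(\<integral>\<omega>. u \<omega> * (1 + V (x (Suc n) \<omega>)) \<partial>P)
        \<le> (1 + 4 * K * D * (a n)\<^sup>2) * (\<integral>\<omega>. u \<omega> * (1 + V (x n \<omega>)) \<partial>P) - a n * (\<integral>\<omega>. u \<omega> * g (x n \<omega>) \<partial>P)"
      by (rule one_step(3))
    also have "a n * (\<integral>\<omega>. u \<omega> * g (x n \<omega>) \<partial>P) = (\<integral>\<omega>. indicator A \<omega> * S n \<omega> \<partial>P)"
      by (simp add: u_def S_def mult_ac flip: integral_mult_right_zero)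
    finally show "(\<integral>\<omega>. indicator A \<omega> * U (Suc n) \<omega> \<partial>P)
        \<le> (1 + 4 * K * D * (a n)\<^sup>2) * (\<integral>\<omega>. indicator A \<omega> * U n \<omega> \<partial>P) - (\<integral>\<omega>. indicator A \<omega> * S n \<omega> \<partial>P)"
      by (simp add: u_def U_def mult.assoc)
  qed
  then have "AE \<omega> in P. (\<lambda>n. infdist (x n \<omega>) H) \<longlonglongrightarrow> 0"
  proof eventually_elim
    case (elim \<omega>)
    have "convergent (\<lambda>n. U n \<omega> * inverse (w \<omega>) - 1)"
      using elim by (intro convergent_diff convergent_mult convergent_const) auto
    moreover have "U n \<omega> * inverse (w \<omega>) - 1 = V (x n \<omega>)" for n
      using w_pos[of \<omega>] by (simp add: U_def field_simps)
    ultimately have conv: "convergent (\<lambda>n. V (x n \<omega>))" by simp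
    obtain B where B: "\<And>n. (\<Sum>k<n. S k \<omega>) \<le> B" using elim by blast
    have "(\<Sum>k<n. a k * g (x k \<omega>)) \<le> B / w \<omega>" for n
    proof -
      have "(\<Sum>k<n. a k * g (x k \<omega>)) * w \<omega> = (\<Sum>k<n. S k \<omega>)"
        unfolding sum_distrib_right S_def by (simp only: mult_ac)
      then show ?thesis using B[of n] w_pos[of \<omega>] by (simp add: pos_le_divide_eq)
    qed
    moreover have "V y = 0" if "g y = 0" for y
      using that H_def H_zero by (auto simp: g_def)
    ultimately show ?case unfolding H_zero
      by (intro lyapunov_convergent_imp_infdist[OF V_nonneg contV V_coercive g0 contg _ A2_pos A2_sum conv])
  qed
  moreover have "{\<omega> \<in> space P. (\<lambda>n. infdist (x n \<omega>) H) \<longlonglongrightarrow> 0} \<in> sets P"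
  proof -
    have [measurable]: "(\<lambda>z. infdist z H) \<in> borel_measurable borel"
      by (intro borel_measurable_continuous_onI continuous_intros)
    show ?thesis by measurable
  qed
  ultimately show ?thesis by (simp add: prob_Collect_eq_1)
qed

end
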